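(* Let $f\in\mathbb{R}[x,y]$ be a polynomial of degree $n\ge 2$, let $f_n$ be its homogeneous part of degree $n$, and let $\mathcal{PD}$ be the quadratic differential form of principal directions of $f$ on $\mathbb{R}^2$. The projective extension of $\mathcal{PD}$ is determined by an analytic quadratic differential form $\Phi$ defined on the whole unit sphere $\mathbb{S}^2$; that is, there exists an analytic quadratic differential form $\Phi$ on $\mathbb{S}^2$ with the following properties: (i) the two direction fields defined by $\Phi$ on the upper open hemisphere $\mathcal{H}^+$ and on the lower open hemisphere $\mathcal{H}^-$ are the zero loci of the induced quadratic forms $s_1^{*}(\mathcal{PD})$ and $s_2^{*}(\mathcal{PD})$, respectively; (ii) if $f_n$ has no repeated real linear factors, then, away from the singular points of $\Phi$, the equator $\mathbb{S}^2\cap\{\omega=0\}$ is an integral curve of a solution field of $\Phi$.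
   Context: The form of principal directions of $f$ is the quadratic differential form on $\mathbb{R}^2$ $$\mathcal{PD}=\big(f_{xy}+f_{xy}f_x^2-f_xf_yf_{xx}\big)dx^2+\big(f_{yy}(1+f_x^2)-f_{xx}(1+f_y^2)\big)dx\,dy+\big(f_xf_yf_{yy}-f_{xy}-f_{xy}f_y^2\big)dy^2 .$$ Its zero directions are the projections to the $xy$-plane of the principal directions of the graph of $f$. Let $\mathbb{S}^2=\{(u,v,\omega)\in\mathbb{R}^3: u^2+v^2+\omega^2=1\}$, $\mathcal{H}^+=\mathbb{S}^2\cap\{\omega>0\}$ and $\mathcal{H}^-=\mathbb{S}^2\cap\{\omega<0\}$. The projections of Poincaré are the diffeomorphisms $s_1:\mathbb{R}^2\to\mathcal{H}^+$ and $s_2:\mathbb{R}^2\to\mathcal{H}^-$ given by $s_1(x,y)=\frac{(x,y,1)}{\sqrt{1+x^2+y^2}}$ and $s_2(x,y)=-\frac{(x,y,1)}{\sqrt{1+x^2+y^2}}$. The induced form $s_j^{*}(\mathcal{PD})$ denotes the quadratic differential form on the corresponding hemisphere obtained by transporting $\mathcal{PD}$ with $s_j$, i.e. the pullback of $\mathcal{PD}$ by $s_j^{-1}$. For a quadratic differential form $\eta$ on a surface $S$, $\eta(p)$ denotes its restriction to $T_pS$; $p$ is a singular point of $\eta$ if $\eta(p)$ vanishes identically on $T_pS$. The direction fields defined by $\eta$ (its solution fields) are the fields of directions contained in the zero set $\eta(p)^{-1}(0)\subset T_pS$ at the nonsingular points $p$. *)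

theory Defs
  imports "HOL-Analysis.Analysis" "HOL-Computational_Algebra.Polynomial"
begin

section \<open>Polynomials in two real variables\<close>

text \<open>
  A polynomial in \<open>\<real>[x, y] = \<real>[x][y]\<close> is a value of type \<^typ>\<open>real poly poly\<close>: the outer
  indeterminate is \<open>y\<close>, the inner one is \<open>x\<close>, and the coefficient of \<open>x^i y^j\<close> is
  \<open>coeff (coeff f j) i\<close>.
\<close>

definition eval2 :: "real poly poly \<Rightarrow> real \<Rightarrow> real \<Rightarrow> real" where
  "eval2 f x y = poly (poly f [:y:]) x"

definition d_x :: "real poly poly \<Rightarrow> real poly poly" where
  "d_x f = map_poly pderiv f"

definition d_y :: "real poly poly \<Rightarrow> real poly poly" where
  "d_y f = pderiv f"

lemma eval2_has_derivative_y:
  "((\<lambda>y. eval2 f x y) has_field_derivative eval2 (d_y f) x y) (at y)"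
proof -
  have "((\<lambda>y. eval2 f x y) has_field_derivative eval2 (d_y f) x y) (at y)" for y
  proof (induction f)
    case 0
    then show ?case by (simp add: eval2_def d_y_def)
  next
    case (pCons a f)
    show ?case
      using pCons.IH
      by (auto simp: eval2_def d_y_def pderiv_pCons intro!: derivative_eq_intros)
  qed
  then show ?thesis .
qed

lemma eval2_has_derivative_x:
  "((\<lambda>x. eval2 f x y) has_field_derivative eval2 (d_x f) x y) (at x)"
proof (induction f)
  case 0
  then show ?case by (simp add: eval2_def d_x_def)
next
  case (pCons a f)
  have "map_poly pderiv (pCons a f) = pCons (pderiv a) (map_poly pderiv f)"
    by (simp add: map_poly_pCons)
  then have "eval2 (d_x (pCons a f)) x y = poly (pderiv a) x + y * eval2 (d_x f) x y"
    by (simp add: eval2_def d_x_def)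
  moreover have "(\<lambda>x. eval2 (pCons a f) x y) = (\<lambda>x. poly a x + y * eval2 f x y)"
    by (simp add: eval2_def fun_eq_iff)
  ultimately show ?case
    using DERIV_add[OF poly_DERIV DERIV_cmult[OF pCons.IH]] by simp
qed

definition total_degree :: "real poly poly \<Rightarrow> nat" where
  "total_degree f = Max (insert 0 {i + j | i j. coeff (coeff f j) i \<noteq> 0})"

definition homogeneous_part :: "nat \<Rightarrow> real poly poly \<Rightarrow> real poly poly" where
  "homogeneous_part k f = (\<Sum>j\<le>k. monom (monom (coeff (coeff f j) (k - j)) (k - j)) j)"

lemma coeff_homogeneous_part:
  "coeff (coeff (homogeneous_part k f) j) i = (if i + j = k then coeff (coeff f j) i else 0)"
proof -
  have "coeff (homogeneous_part k f) j =
      (\<Sum>j'\<le>k. if j' = j then monom (coeff (coeff f j) (k - j)) (k - j) else 0)"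
    by (auto simp: homogeneous_part_def coeff_sum intro!: sum.cong)
  also have "\<dots> = (if j \<le> k then monom (coeff (coeff f j) (k - j)) (k - j) else 0)"
    by simp
  finally show ?thesis
    by auto
qed

definition no_repeated_linear_factor :: "real poly poly \<Rightarrow> bool" where
  "no_repeated_linear_factor g \<longleftrightarrow> (\<forall>l. total_degree l = 1 \<longrightarrow> \<not> l ^ 2 dvd g)"


section \<open>The form of principal directions\<close>

text \<open>
  A quadratic differential form is a function of a base point and a tangent vector; here
  \<open>X$1\<close> and \<open>X$2\<close> are the values of \<open>dx\<close> and \<open>dy\<close> on \<open>X\<close>.
\<close>

definition principal_form :: "real poly poly \<Rightarrow> real^2 \<Rightarrow> real^2 \<Rightarrow> real" where
  "principal_form f p X =
    (let fx = eval2 (d_x f) (p$1) (p$2);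
         fy = eval2 (d_y f) (p$1) (p$2);
         fxx = eval2 (d_x (d_x f)) (p$1) (p$2);
         fxy = eval2 (d_y (d_x f)) (p$1) (p$2);
         fyy = eval2 (d_y (d_y f)) (p$1) (p$2)
     in (fxy + fxy * fx^2 - fx * fy * fxx) * (X$1)^2
        + (fyy * (1 + fx^2) - fxx * (1 + fy^2)) * (X$1 * X$2)
        + (fx * fy * fyy - fxy - fxy * fy^2) * (X$2)^2)"


section \<open>Quadratic differential forms on the unit sphere\<close>

abbreviation S2 :: "(real^3) set" where
  "S2 \<equiv> sphere 0 1"

definition upper_hemisphere :: "(real^3) set" where
  "upper_hemisphere = {p \<in> S2. p$3 > 0}"

definition lower_hemisphere :: "(real^3) set" where
  "lower_hemisphere = {p \<in> S2. p$3 < 0}"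

definition tangent_space :: "real^3 \<Rightarrow> (real^3) set" where
  "tangent_space p = {X. p \<bullet> X = 0}"

text \<open>
  Real analyticity in several variables: local expansion in a power series, indexed by the
  multi-indices \<open>\<alpha>\<close>. For real terms \<open>has_sum\<close> is absolute convergence, so no order of
  summation has to be chosen.
\<close>

definition real_analytic_on :: "(real^'n \<Rightarrow> real) \<Rightarrow> (real^'n) set \<Rightarrow> bool" where
  "real_analytic_on g U \<longleftrightarrow>
    (\<forall>p\<in>U. \<exists>r>0. \<exists>c :: ('n \<Rightarrow> nat) \<Rightarrow> real. \<forall>h. (\<forall>i. \<bar>h$i\<bar> < r) \<longrightarrow>
       ((\<lambda>\<alpha>. c \<alpha> * (\<Prod>i\<in>UNIV. (h$i) ^ \<alpha> i)) has_sum g (p + h)) UNIV)"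

text \<open>
  A quadratic form on the tangent spaces of the embedded surface \<open>S2\<close> is analytic if near every
  point it is the restriction of a form \<open>\<Sum>i j. a\<^sub>i\<^sub>j dx\<^sub>i dx\<^sub>j\<close> with analytic coefficients
  on an open subset of the ambient space. Only the values \<open>\<Phi> p X\<close> with \<open>p \<in> S2\<close> and
  \<open>X \<in> tangent_space p\<close> matter.
\<close>

definition analytic_quadratic_form :: "(real^3 \<Rightarrow> real^3 \<Rightarrow> real) \<Rightarrow> bool" where
  "analytic_quadratic_form \<Phi> \<longleftrightarrow>
    (\<forall>p\<in>S2. \<exists>U. \<exists>a :: 3 \<Rightarrow> 3 \<Rightarrow> real^3 \<Rightarrow> real.
       open U \<and> p \<in> U \<and> (\<forall>i j. real_analytic_on (a i j) U) \<and>
       (\<forall>q \<in> U \<inter> S2. \<forall>X \<in> tangent_space q.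
          \<Phi> q X = (\<Sum>i\<in>UNIV. \<Sum>j\<in>UNIV. a i j q * (X$i) * (X$j))))"

definition zero_locus :: "(real^3 \<Rightarrow> real^3 \<Rightarrow> real) \<Rightarrow> real^3 \<Rightarrow> (real^3) set" where
  "zero_locus \<Phi> p = {X \<in> tangent_space p. \<Phi> p X = 0}"

definition singular_points :: "(real^3 \<Rightarrow> real^3 \<Rightarrow> real) \<Rightarrow> (real^3) set" where
  "singular_points \<Phi> = {p \<in> S2. \<forall>X \<in> tangent_space p. \<Phi> p X = 0}"

text \<open>
  A field of directions assigns a line to each nonsingular point. It is not required to be
  continuous: the two lines of the zero locus may come together at a point where the form is
  not singular.
\<close>

definition solution_field ::
    "(real^3 \<Rightarrow> real^3 \<Rightarrow> real) \<Rightarrow> (real^3 \<Rightarrow> (real^3) set) \<Rightarrow> bool" where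
  "solution_field \<Phi> L \<longleftrightarrow>
    (\<forall>p \<in> S2 - singular_points \<Phi>. subspace (L p) \<and> dim (L p) = 1 \<and> L p \<subseteq> zero_locus \<Phi> p)"

text \<open>
  The parameter set \<open>T\<close> need not be connected, but it has to be open and nonempty, so that
  \<open>\<gamma>\<close> really traces a curve.
\<close>

definition integral_curve ::
    "(real^3 \<Rightarrow> (real^3) set) \<Rightarrow> (real \<Rightarrow> real^3) \<Rightarrow> real set \<Rightarrow> bool" where
  "integral_curve L \<gamma> T \<longleftrightarrow> open T \<and> T \<noteq> {} \<and>
    (\<forall>t\<in>T. \<exists>v. (\<gamma> has_vector_derivative v) (at t) \<and> v \<noteq> 0 \<and> v \<in> L (\<gamma> t))"

definition equator :: "real \<Rightarrow> real^3" where
  "equator t = vector [cos t, sin t, 0]"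

lemma range_equator: "range equator = {p \<in> S2. p$3 = 0}"
proof
  show "range equator \<subseteq> {p \<in> S2. p$3 = 0}"
    by (auto simp: equator_def norm_vec_def L2_set_def sum_3)
  show "{p \<in> S2. p$3 = 0} \<subseteq> range equator"
  proof
    fix p :: "real^3" assume p: "p \<in> {p \<in> S2. p$3 = 0}"
    then have "(p$1)^2 + (p$2)^2 = 1"
      by (auto simp add: norm_vec_def L2_set_def sum_3)
    then obtain t where "p$1 = cos t" "p$2 = sin t"
      by (metis sincos_total_2pi)
    with p have "p = equator t"
      by (simp add: vec_eq_iff forall_3 equator_def)
    then show "p \<in> range equator" by blast
  qed
qed


section \<open>The Poincare projections and the induced forms\<close>

definition s1 :: "real^2 \<Rightarrow> real^3" where
  "s1 p = (1 / sqrt (1 + (p$1)^2 + (p$2)^2)) *\<^sub>R vector [p$1, p$2, 1]"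

definition s2 :: "real^2 \<Rightarrow> real^3" where
  "s2 p = - (1 / sqrt (1 + (p$1)^2 + (p$2)^2)) *\<^sub>R vector [p$1, p$2, 1]"

text \<open>
  The pullback of \<open>\<eta>\<close> by the inverse of \<open>s\<close>. The differential of \<open>s\<^sup>-\<^sup>1\<close> at \<open>q = s p\<close> is the
  inverse of the differential of \<open>s\<close> at \<open>p\<close>, a linear isomorphism onto the tangent space at \<open>q\<close>.
  The value is meaningful only for \<open>q\<close> in the range of \<open>s\<close> and \<open>X\<close> tangent at \<open>q\<close>.
\<close>

definition induced_form ::
    "(real^2 \<Rightarrow> real^3) \<Rightarrow> (real^2 \<Rightarrow> real^2 \<Rightarrow> real) \<Rightarrow> real^3 \<Rightarrow> real^3 \<Rightarrow> real" where
  "induced_form s \<eta> q X =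
    (let p = inv s q in \<eta> p (inv (frechet_derivative s (at p)) X))"

end

theory Submission
  imports Defs
begin

text \<open>
  Let \<open>F(u, v, w)\<close> be the homogenization of \<open>f\<close> to degree \<open>n\<close>. Replacing the partial
  derivatives of \<open>f\<close> in the coefficients of PD by those of \<open>F\<close>, and \<open>1\<close> by \<open>w\<^sup>2\<^sup>n\<^sup>-\<^sup>2\<close> where
  the degree requires it, gives polynomials \<open>A\<close>, \<open>B\<close>, \<open>C\<close>, homogeneous of degree \<open>3n - 4\<close>.
  Since \<open>dx = (w du - u dw) / w\<^sup>2\<close> and \<open>dy = (w dv - v dw) / w\<^sup>2\<close>, the pullback of PD has, off
  the equator, the same zeros as the polynomial form \<open>A (w du - u dw)\<^sup>2 + B (w du - u dw) (w
  dv - v dw) + C (w dv - v dw)\<^sup>2\<close>. On the equator this form is \<open>(A u\<^sup>2 + B u v + C v\<^sup>2) dw\<^sup>2\<close>,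
  and Euler's identity for \<open>F\<close> shows that \<open>A u\<^sup>2 + B u v + C v\<^sup>2\<close> is divisible by \<open>w\<close>, with a
  quotient \<open>E\<close> that can be written down (\<open>radial_value_eq\<close>). So the whole form can be divided
  by \<open>w\<close>; the quotient is \<open>\<Phi> = w (A du\<^sup>2 + B du dv + C dv\<^sup>2) - dw (2 A u du + B (u dv + v du)
  + 2 C v dv) + E dw\<^sup>2\<close>. It is analytic because its coefficients are polynomials, it has the
  required zeros on both hemispheres, and for \<open>w = 0\<close> it contains the factor \<open>dw\<close>, which
  vanishes on the tangents of the equator.

  Two points remain. A solution field must provide a real zero direction at every nonsingular
  point. On the equator this is the tangent, elsewhere one exists because principal directions
  are real: PD is trace-free with respect to the first fundamental form
  (\<open>principal_form_discriminant\<close>). And the equator must contain nonsingular points at all. If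
  it did not, then the mixed coefficient of \<open>\<Phi>\<close>, which at \<open>(1, y, 0)\<close> is up to a nonzero
  factor \<open>h (n h h'' - (n - 1) h'\<^sup>2)\<close> with \<open>h(y) = f\<^sub>n(1, y)\<close> (\<open>equator_mixed_eq_hessian\<close>),
  would vanish for all \<open>y\<close>. Here \<open>h \<noteq> 0\<close>, and the second factor is, up to a constant, the
  Hessian determinant of \<open>f\<^sub>n\<close> on the line \<open>x = 1\<close>. A binary form with vanishing Hessian is a
  power of a linear form; it is enough here to find a repeated real linear factor
  (\<open>repeated_factor_of_hessian_eq_0\<close>).
\<close>


section \<open>Polynomial functions are real analytic\<close>

text \<open>
  One family of coefficients serves for all \<open>h\<close>: for polynomials the radius of convergence in
  \<open>real_analytic_on\<close> is of no concern.
\<close>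

definition has_global_expansion :: "(real^'n \<Rightarrow> real) \<Rightarrow> bool" where
  "has_global_expansion g \<longleftrightarrow>
    (\<exists>c :: ('n \<Rightarrow> nat) \<Rightarrow> real. \<forall>h. ((\<lambda>\<alpha>. c \<alpha> * (\<Prod>i\<in>UNIV. (h$i) ^ \<alpha> i)) has_sum g h) UNIV)"

lemma has_global_expansion_add:
  assumes "has_global_expansion g1" and "has_global_expansion g2"
  shows "has_global_expansion (\<lambda>h. g1 h + g2 h)"
proof -
  obtain c1 c2 where
    "\<And>h. ((\<lambda>\<alpha>. c1 \<alpha> * (\<Prod>i\<in>UNIV. (h$i) ^ \<alpha> i)) has_sum g1 h) UNIV"
    "\<And>h. ((\<lambda>\<alpha>. c2 \<alpha> * (\<Prod>i\<in>UNIV. (h$i) ^ \<alpha> i)) has_sum g2 h) UNIV"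
    using assms unfolding has_global_expansion_def by blast
  then have "((\<lambda>\<alpha>. (c1 \<alpha> + c2 \<alpha>) * (\<Prod>i\<in>UNIV. (h$i) ^ \<alpha> i)) has_sum (g1 h + g2 h)) UNIV" for h
    unfolding distrib_right by (intro has_sum_add)
  then show ?thesis
    unfolding has_global_expansion_def by (intro exI[of _ "\<lambda>\<alpha>. c1 \<alpha> + c2 \<alpha>"]) simp
qed

lemma has_global_expansion_cmult:
  assumes "has_global_expansion g"
  shows "has_global_expansion (\<lambda>h. a * g h)"
proof -
  obtain c where "\<And>h. ((\<lambda>\<alpha>. c \<alpha> * (\<Prod>i\<in>UNIV. (h$i) ^ \<alpha> i)) has_sum g h) UNIV"
    using assms unfolding has_global_expansion_def by blast
  then have "((\<lambda>\<alpha>. (a * c \<alpha>) * (\<Prod>i\<in>UNIV. (h$i) ^ \<alpha> i)) has_sum (a * g h)) UNIV" for h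
    unfolding mult.assoc by (intro has_sum_cmult_right)
  then show ?thesis
    unfolding has_global_expansion_def by (intro exI[of _ "\<lambda>\<alpha>. a * c \<alpha>"]) simp
qed

lemma has_global_expansion_sum:
  assumes "finite I" and "\<And>i. i \<in> I \<Longrightarrow> has_global_expansion (g i)"
  shows "has_global_expansion (\<lambda>h. \<Sum>i\<in>I. g i h)"
  using assms
proof (induction rule: finite_induct)
  case empty
  show ?case
    unfolding has_global_expansion_def by (intro exI[of _ "\<lambda>_. 0"]) simp
qed (simp add: has_global_expansion_add)

lemma has_global_expansion_one: "has_global_expansion (\<lambda>h :: real^'n. 1)"
  unfolding has_global_expansion_def
proof (intro exI allI)
  fix h :: "real^'n"
  have "((\<lambda>\<alpha> :: 'n \<Rightarrow> nat. of_bool (\<alpha> = (\<lambda>_. 0)) * (\<Prod>i\<in>UNIV. (h$i) ^ \<alpha> i)) has_sum 1) {\<lambda>_. 0}"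
    by (intro has_sum_finiteI) auto
  then show "((\<lambda>\<alpha> :: 'n \<Rightarrow> nat. of_bool (\<alpha> = (\<lambda>_. 0)) * (\<Prod>i\<in>UNIV. (h$i) ^ \<alpha> i)) has_sum 1) UNIV"
    by (rule has_sum_cong_neutral[THEN iffD1, rotated -1]) auto
qed

text \<open>
  Multiplication by the coordinate \<open>h$k\<close> shifts the family of coefficients by the \<open>k\<close>-th unit
  multi-index.
\<close>

lemma has_global_expansion_times_coordinate:
  fixes g :: "real^'n \<Rightarrow> real"
  assumes "has_global_expansion g"
  shows "has_global_expansion (\<lambda>h. h$k * g h)"
proof -
  obtain c where c: "\<And>h. ((\<lambda>\<alpha>. c \<alpha> * (\<Prod>i\<in>UNIV. (h$i) ^ \<alpha> i)) has_sum g h) UNIV"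
    using assms unfolding has_global_expansion_def by blast
  define shift :: "('n \<Rightarrow> nat) \<Rightarrow> 'n \<Rightarrow> nat" where "shift \<alpha> = \<alpha>(k := Suc (\<alpha> k))" for \<alpha>
  define c' where "c' \<alpha> = (if \<alpha> k = 0 then 0 else c (\<alpha>(k := \<alpha> k - 1)))" for \<alpha>
  have inj: "inj shift"
    by (rule inj_on_inverseI[where g = "\<lambda>\<alpha>. \<alpha>(k := \<alpha> k - 1)"]) (simp add: shift_def)
  have outside: "c' \<alpha> = 0" if "\<alpha> \<notin> range shift" for \<alpha>
  proof (rule ccontr)
    assume "c' \<alpha> \<noteq> 0"
    then have "\<alpha> = shift (\<alpha>(k := \<alpha> k - 1))"
      by (auto simp: c'_def shift_def fun_eq_iff split: if_splits)
    with that show False by blast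
  qed
  have "((\<lambda>\<alpha>. c' \<alpha> * (\<Prod>i\<in>UNIV. (h$i) ^ \<alpha> i)) has_sum (h$k * g h)) UNIV" for h
  proof -
    have prod: "(\<Prod>i\<in>UNIV. (h$i) ^ shift \<alpha> i) = h$k * (\<Prod>i\<in>UNIV. (h$i) ^ \<alpha> i)" for \<alpha>
      by (simp add: shift_def prod.remove[of UNIV k])
    have "((\<lambda>\<alpha>. h$k * (c \<alpha> * (\<Prod>i\<in>UNIV. (h$i) ^ \<alpha> i))) has_sum (h$k * g h)) UNIV"
      by (intro has_sum_cmult_right c)
    also have "(\<lambda>\<alpha>. h$k * (c \<alpha> * (\<Prod>i\<in>UNIV. (h$i) ^ \<alpha> i))) =
        (\<lambda>\<alpha>. c' \<alpha> * (\<Prod>i\<in>UNIV. (h$i) ^ \<alpha> i)) \<circ> shift"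
      unfolding o_def prod by (simp add: c'_def shift_def fun_eq_iff)
    finally have "((\<lambda>\<alpha>. c' \<alpha> * (\<Prod>i\<in>UNIV. (h$i) ^ \<alpha> i)) has_sum (h$k * g h)) (range shift)"
      using has_sum_reindex[OF inj] by blast
    then show ?thesis
      by (rule has_sum_cong_neutral[THEN iffD1, rotated -1]) (auto simp: outside)
  qed
  then show ?thesis
    unfolding has_global_expansion_def by blast
qed

text \<open>
  The product with an arbitrary expandable \<open>g\<close> makes the induction over polynomial functions go
  through without multiplying two expansions: in the product case the two induction hypotheses
  are applied one after the other.
\<close>

lemma has_global_expansion_times_polynomial:
  fixes q g :: "real^'n \<Rightarrow> real"
  assumes "real_polynomial_function q" and "has_global_expansion g"
  shows "has_global_expansion (\<lambda>h. q (p + h) * g h)"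
  using assms
proof (induction q arbitrary: g rule: real_polynomial_function.induct)
  case (linear q)
  have "q (p + h) * g h = q p * g h + (\<Sum>i\<in>UNIV. q (axis i 1) * (h$i * g h))" for h
  proof -
    have "q h = q (\<Sum>i\<in>UNIV. h$i *\<^sub>R axis i 1)"
      using basis_expansion[of h] by (simp add: scalar_mult_eq_scaleR)
    also have "\<dots> = (\<Sum>i\<in>UNIV. h$i * q (axis i 1))"
      using linear(1) by (simp add: bounded_linear.linear linear_sum linear_scale)
    finally have "q (p + h) = q p + (\<Sum>i\<in>UNIV. h$i * q (axis i 1))"
      using linear(1) by (simp add: bounded_linear.linear linear_add)
    then show ?thesis
      by (simp add: algebra_simps sum_distrib_left sum_distrib_right)
  qed
  then show ?case
    using linear(2)
    by (simp add: has_global_expansion_add has_global_expansion_sum has_global_expansion_cmult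
        has_global_expansion_times_coordinate)
next
  case (const c)
  then show ?case by (rule has_global_expansion_cmult)
next
  case (add q1 q2)
  then show ?case by (simp add: distrib_right has_global_expansion_add)
next
  case (mult q1 q2)
  then show ?case by (simp add: mult.assoc)
qed

lemma real_polynomial_function_imp_real_analytic_on:
  fixes q :: "real^'n \<Rightarrow> real"
  assumes "real_polynomial_function q"
  shows "real_analytic_on q U"
proof -
  have "has_global_expansion (\<lambda>h. q (p + h))" for p
    using has_global_expansion_times_polynomial[OF assms has_global_expansion_one] by simp
  then show ?thesis
    unfolding real_analytic_on_def has_global_expansion_def by (meson zero_less_one)
qed

lemma real_polynomial_function_power:
  "real_polynomial_function q \<Longrightarrow> real_polynomial_function (\<lambda>x. q x ^ k)"
  by (induction k) (auto intro: real_polynomial_function.intros)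

lemma real_polynomial_function_coordinate: "real_polynomial_function (\<lambda>p :: real^'n. p$k)"
  by (intro real_polynomial_function.intros(1) bounded_linear_vec_nth)


section \<open>Homogenization and its partial derivatives\<close>

text \<open>
  The \<open>a\<close>-th derivative of \<open>x ^ i\<close>. For \<open>a > i\<close> the product has a factor zero, so that the
  truncated exponent does no harm.
\<close>

definition power_deriv :: "nat \<Rightarrow> nat \<Rightarrow> real \<Rightarrow> real" where
  "power_deriv a i x = (\<Prod>k<a. real i - real k) * x ^ (i - a)"

lemma power_deriv_eq_0: "i < a \<Longrightarrow> power_deriv a i x = 0"
  by (auto simp: power_deriv_def)

lemma power_deriv_0 [simp]: "power_deriv 0 i x = x ^ i"
  by (simp add: power_deriv_def)

lemma times_power_deriv_Suc: "x * power_deriv (Suc a) i x = (real i - real a) * power_deriv a i x"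
proof -
  consider "i < a" | "i = a" | "i > a" by linarith
  then show ?thesis
  proof cases
    case 3
    then have "i - a = Suc (i - Suc a)" by simp
    then show ?thesis by (simp add: power_deriv_def)
  qed (auto simp: power_deriv_eq_0)
qed

lemma DERIV_power_deriv: "(power_deriv a i has_field_derivative power_deriv (Suc a) i x) (at x)"
proof -
  have "((\<lambda>x. (\<Prod>k<a. real i - real k) * x ^ (i - a)) has_field_derivative
      (\<Prod>k<a. real i - real k) * (real (i - a) * x ^ (i - a - 1))) (at x)"
    by (auto intro!: derivative_eq_intros)
  also have "(\<Prod>k<a. real i - real k) * (real (i - a) * x ^ (i - a - 1)) = power_deriv (Suc a) i x"
  proof (cases "i < a")
    case True
    then show ?thesis by (auto simp: power_deriv_def)
  next
    case False
    then show ?thesis by (simp add: power_deriv_def of_nat_diff)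
  qed
  finally show ?thesis
    by (simp add: power_deriv_def[abs_def])
qed

lemma power_deriv_scale: "t ^ a * power_deriv a i (t * x) = t ^ i * power_deriv a i x"
proof (cases "i < a")
  case False
  then have "t ^ a * t ^ (i - a) = t ^ i" by (simp flip: power_add)
  then show ?thesis by (simp add: power_deriv_def power_mult_distrib ac_simps)
qed (simp add: power_deriv_eq_0)

text \<open>
  The partial derivative of order \<open>a\<close>, \<open>b\<close>, \<open>c\<close> in \<open>u\<close>, \<open>v\<close>, \<open>w\<close> of the homogenization
  \<open>w ^ n f(u / w, v / w)\<close>. As a sum over monomials it is also defined for \<open>w = 0\<close>.
\<close>

definition hom_partial ::
    "real poly poly \<Rightarrow> nat \<Rightarrow> nat \<Rightarrow> nat \<Rightarrow> nat \<Rightarrow> real \<Rightarrow> real \<Rightarrow> real \<Rightarrow> real" where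
  "hom_partial f n a b c u v w =
    (\<Sum>i\<le>n. \<Sum>j\<le>n - i. coeff (coeff f j) i *
       (power_deriv a i u * power_deriv b j v * power_deriv c (n - i - j) w))"

text \<open>
  Euler's identity for the partial derivatives, which are homogeneous of degree \<open>n - a - b - c\<close>.
\<close>

lemma hom_partial_euler:
  "u * hom_partial f n (Suc a) b c u v w + v * hom_partial f n a (Suc b) c u v w
     + w * hom_partial f n a b (Suc c) u v w
   = (real n - real a - real b - real c) * hom_partial f n a b c u v w"
proof -
  have "u * (k * (power_deriv (Suc a) i u * power_deriv b j v * power_deriv c (n - i - j) w))
      + v * (k * (power_deriv a i u * power_deriv (Suc b) j v * power_deriv c (n - i - j) w))
      + w * (k * (power_deriv a i u * power_deriv b j v * power_deriv (Suc c) (n - i - j) w))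
      = (real n - real a - real b - real c) *
        (k * (power_deriv a i u * power_deriv b j v * power_deriv c (n - i - j) w))"
    if "i \<le> n" "j \<le> n - i" for k i j
  proof -
    have "real (n - i - j) = real n - real i - real j" using that by simp
    then show ?thesis
      using times_power_deriv_Suc[of u a i] times_power_deriv_Suc[of v b j]
        times_power_deriv_Suc[of w c "n - i - j"]
      by algebra
  qed
  then show ?thesis
    unfolding hom_partial_def sum_distrib_left sum.distrib[symmetric]
    by (intro sum.cong) auto
qed

lemma hom_partial_scale:
  "t ^ (a + b + c) * hom_partial f n a b c (t * u) (t * v) (t * w) = t ^ n * hom_partial f n a b c u v w"
proof -
  have "t ^ (a + b + c) * (k * (power_deriv a i (t * u) * power_deriv b j (t * v) *
        power_deriv c (n - i - j) (t * w)))
      = t ^ n * (k * (power_deriv a i u * power_deriv b j v * power_deriv c (n - i - j) w))"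
    if "i \<le> n" "j \<le> n - i" for k i j
  proof -
    have "t ^ n = t ^ i * t ^ j * t ^ (n - i - j)"
      using that by (simp flip: power_add)
    moreover have "t ^ (a + b + c) * (k * (power_deriv a i (t * u) * power_deriv b j (t * v) *
          power_deriv c (n - i - j) (t * w)))
        = k * (t ^ a * power_deriv a i (t * u)) * (t ^ b * power_deriv b j (t * v)) *
          (t ^ c * power_deriv c (n - i - j) (t * w))"
      by (simp add: power_add)
    ultimately show ?thesis
      by (simp only: power_deriv_scale ac_simps)
  qed
  then show ?thesis
    unfolding hom_partial_def sum_distrib_left
    by (intro sum.cong) auto
qed

lemma DERIV_hom_partial_u:
  "((\<lambda>u. hom_partial f n a b c u v w) has_field_derivative hom_partial f n (Suc a) b c u v w) (at u)"
  unfolding hom_partial_def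
  by (intro DERIV_sum DERIV_cmult DERIV_cmult_right DERIV_power_deriv)

lemma DERIV_hom_partial_v:
  "((\<lambda>v. hom_partial f n a b c u v w) has_field_derivative hom_partial f n a (Suc b) c u v w) (at v)"
  unfolding hom_partial_def
  by (intro DERIV_sum DERIV_cmult DERIV_cmult_right DERIV_power_deriv)

lemma real_polynomial_function_hom_partial:
  "real_polynomial_function (\<lambda>p :: real^3. hom_partial f n a b c (p$1) (p$2) (p$3))"
  unfolding hom_partial_def power_deriv_def
  by (intro real_polynomial_function_sum real_polynomial_function.intros(2,4)
      real_polynomial_function_power
      real_polynomial_function_coordinate finite_atMost)

lemma finite_monomials: "finite {(i, j). coeff (coeff (f :: real poly poly) j) i \<noteq> 0}"
proof (rule finite_subset)
  show "{(i, j). coeff (coeff f j) i \<noteq> 0} \<subseteq> (\<lambda>(j, i). (i, j)) ` (SIGMA j:{..degree f}. {..degree (coeff f j)})"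
    by (force simp: image_iff intro: le_degree)
qed simp

lemma degrees_eq_image:
  "{i + j | i j. coeff (coeff (f :: real poly poly) j) i \<noteq> 0}
    = (\<lambda>(i, j). i + j) ` {(i, j). coeff (coeff f j) i \<noteq> 0}"
  by auto

lemma le_total_degree: "coeff (coeff f j) i \<noteq> 0 \<Longrightarrow> i + j \<le> total_degree f"
  unfolding total_degree_def
  by (intro Max_ge) (auto simp: degrees_eq_image finite_monomials)

lemma total_degree_attained:
  assumes "total_degree f > 0"
  obtains i j where "coeff (coeff f j) i \<noteq> 0" "i + j = total_degree f"
proof -
  have "total_degree f \<in> insert 0 {i + j | i j. coeff (coeff f j) i \<noteq> 0}"
    unfolding total_degree_def by (intro Max_in) (auto simp: degrees_eq_image finite_monomials)
  with assms that show ?thesis by auto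
qed

lemma eval2_eq_hom_partial:
  assumes "total_degree f \<le> n"
  shows "eval2 f x y = hom_partial f n 0 0 0 x y 1"
proof -
  have c: "coeff (coeff f j) i = 0" if "i + j > n" for i j
    using le_total_degree[of f j i] assms that by force
  have pc: "poly p x = (\<Sum>i\<le>m. coeff p i * x ^ i)" if "\<forall>i>m. coeff p i = 0" for p :: "real poly" and m
    unfolding poly_altdef using degree_le[OF that]
    by (intro sum.mono_neutral_left) (auto simp: coeff_eq_0)
  have "degree f \<le> n" by (intro degree_le) (auto simp: poly_eq_iff c)
  then have "poly f [:y:] = (\<Sum>j\<le>n. coeff f j * [:y:] ^ j)"
    unfolding poly_altdef by (intro sum.mono_neutral_left) (auto simp: coeff_eq_0)
  then have "eval2 f x y = (\<Sum>j\<le>n. poly (coeff f j) x * y ^ j)"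
    by (simp add: eval2_def poly_sum poly_power)
  also have "\<dots> = (\<Sum>j\<le>n. \<Sum>i\<le>n. coeff (coeff f j) i * (x ^ i * y ^ j))"
    by (intro sum.cong) (auto simp: pc[of n] c sum_distrib_right mult.assoc)
  also have "\<dots> = (\<Sum>i\<le>n. \<Sum>j\<le>n. coeff (coeff f j) i * (x ^ i * y ^ j))"
    by (rule sum.swap)
  also have "\<dots> = (\<Sum>i\<le>n. \<Sum>j\<le>n - i. coeff (coeff f j) i * (x ^ i * y ^ j))"
    by (intro sum.cong refl sum.mono_neutral_right) (auto simp: c)
  finally show ?thesis
    by (simp add: hom_partial_def)
qed

text \<open>
  Both sides are partial derivatives of the same function of \<open>x\<close> and \<open>y\<close>, so that the
  uniqueness of derivatives replaces a comparison of coefficients.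
\<close>

lemma eval2_partial_eq_hom_partial:
  assumes "total_degree f \<le> n"
  shows "eval2 ((d_y ^^ b) ((d_x ^^ a) f)) x y = hom_partial f n a b 0 x y 1"
proof -
  have x: "eval2 ((d_x ^^ a) f) x y = hom_partial f n a 0 0 x y 1" for x y
  proof (induction a arbitrary: x)
    case (Suc a)
    have "((\<lambda>x. hom_partial f n a 0 0 x y 1) has_field_derivative
        eval2 ((d_x ^^ Suc a) f) x y) (at x)"
      using eval2_has_derivative_x[of "(d_x ^^ a) f" y x] by (simp add: Suc)
    then show ?case
      using DERIV_hom_partial_u by (rule DERIV_unique)
  qed (simp add: eval2_eq_hom_partial[OF assms])
  show ?thesis
  proof (induction b arbitrary: y)
    case 0
    show ?case by (simp add: x)
  next
    case (Suc b)
    have "((\<lambda>y. hom_partial f n a b 0 x y 1) has_field_derivative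
        eval2 ((d_y ^^ Suc b) ((d_x ^^ a) f)) x y) (at y)"
      using eval2_has_derivative_y[of "(d_y ^^ b) ((d_x ^^ a) f)" x y] by (simp add: Suc)
    then show ?case
      using DERIV_hom_partial_v by (rule DERIV_unique)
  qed
qed

lemma hom_partial_eq_eval2:
  assumes "total_degree f \<le> n" and "a + b \<le> n" and "w \<noteq> 0"
  shows "hom_partial f n a b 0 u v w =
    w ^ (n - a - b) * eval2 ((d_y ^^ b) ((d_x ^^ a) f)) (u / w) (v / w)"
proof -
  have "w ^ (a + b) * hom_partial f n a b 0 u v w = w ^ n * hom_partial f n a b 0 (u / w) (v / w) 1"
    using hom_partial_scale[of w a b 0 f n "u / w" "v / w" 1] assms(3) by simp
  also have "w ^ n = w ^ (a + b) * w ^ (n - a - b)"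
    using assms(2) by (simp flip: power_add)
  finally show ?thesis
    using assms(3) by (simp add: eval2_partial_eq_hom_partial[OF assms(1)])
qed


section \<open>The form on the sphere\<close>

text \<open>
  The coefficients \<open>A\<close>, \<open>B\<close>, \<open>C\<close> of PD, homogenized to degree \<open>3 * n - 4\<close>. A product of three
  derivatives of \<open>f\<close> has this degree already; a single second derivative has degree \<open>n - 2\<close> and
  lacks the factor \<open>w ^ (2 * n - 2)\<close>.
\<close>

definition hom_dx_dx :: "real poly poly \<Rightarrow> nat \<Rightarrow> real \<Rightarrow> real \<Rightarrow> real \<Rightarrow> real" where
  "hom_dx_dx f n u v w =
    (let F = (\<lambda>a b. hom_partial f n a b 0 u v w)
     in w ^ (2 * n - 2) * F 1 1 + F 1 1 * (F 1 0)^2 - F 1 0 * F 0 1 * F 2 0)"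

definition hom_dx_dy :: "real poly poly \<Rightarrow> nat \<Rightarrow> real \<Rightarrow> real \<Rightarrow> real \<Rightarrow> real" where
  "hom_dx_dy f n u v w =
    (let F = (\<lambda>a b. hom_partial f n a b 0 u v w)
     in F 0 2 * (w ^ (2 * n - 2) + (F 1 0)^2) - F 2 0 * (w ^ (2 * n - 2) + (F 0 1)^2))"

definition hom_dy_dy :: "real poly poly \<Rightarrow> nat \<Rightarrow> real \<Rightarrow> real \<Rightarrow> real \<Rightarrow> real" where
  "hom_dy_dy f n u v w =
    (let F = (\<lambda>a b. hom_partial f n a b 0 u v w)
     in F 1 0 * F 0 1 * F 0 2 - w ^ (2 * n - 2) * F 1 1 - F 1 1 * (F 0 1)^2)"

text \<open>
  The quotient \<open>E = (A u\<^sup>2 + B u v + C v\<^sup>2) / w\<close>. In its second summand, the mixed derivatives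
  with \<open>w\<close> are what Euler's identity leaves of the second derivatives along the radial
  direction \<open>(u, v)\<close>.
\<close>

definition hom_radial :: "real poly poly \<Rightarrow> nat \<Rightarrow> real \<Rightarrow> real \<Rightarrow> real \<Rightarrow> real" where
  "hom_radial f n u v w =
    (let F = (\<lambda>a b c. hom_partial f n a b c u v w)
     in w ^ (2 * n - 3) * (F 1 1 0 * (u^2 - v^2) + u * v * (F 0 2 0 - F 2 0 0))
        + (u * F 1 0 0 + v * F 0 1 0) * (F 0 1 0 * F 1 0 1 - F 1 0 0 * F 0 1 1))"

definition projective_form :: "real poly poly \<Rightarrow> nat \<Rightarrow> real^3 \<Rightarrow> real^3 \<Rightarrow> real" where
  "projective_form f n p X =
    (let u = p$1; v = p$2; w = p$3; a = X$1; b = X$2; c = X$3;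
         A = hom_dx_dx f n u v w; B = hom_dx_dy f n u v w; C = hom_dy_dy f n u v w
     in w * (A * a^2 + B * a * b + C * b^2)
        - c * (2 * A * u * a + B * (u * b + v * a) + 2 * C * v * b)
        + c^2 * hom_radial f n u v w)"

text \<open>
  The top-degree part of PD is \<open>X \<mapsto> dF(X) det(\<nabla>F, H X)\<close> with \<open>H\<close> the Hessian matrix. For the
  radial vector \<open>X = (u, v)\<close> and \<open>w = 0\<close>, Euler's identity makes \<open>H X\<close> a multiple of \<open>\<nabla>F\<close>, so
  that the determinant vanishes. This is why the form on the sphere can be divided by \<open>w\<close>.
\<close>

lemma radial_value_eq:
  assumes "n \<ge> 2"
  shows "hom_dx_dx f n u v w * u^2 + hom_dx_dy f n u v w * u * v + hom_dy_dy f n u v w * v^2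
    = w * hom_radial f n u v w"
proof -
  define F where "F a b c = hom_partial f n a b c u v w" for a b c
  have "2 * n - 2 = Suc (2 * n - 3)" using assms by simp
  then have W: "w ^ (2 * n - 2) = w * w ^ (2 * n - 3)" by simp
  have "u * F 2 0 0 + v * F 1 1 0 = (real n - 1) * F 1 0 0 - w * F 1 0 1"
    using hom_partial_euler[of u f n 1 0 0 v w] by (simp add: F_def numeral_2_eq_2)
  moreover have "u * F 1 1 0 + v * F 0 2 0 = (real n - 1) * F 0 1 0 - w * F 0 1 1"
    using hom_partial_euler[of u f n 0 1 0 v w] by (simp add: F_def numeral_2_eq_2)
  ultimately show ?thesis
    unfolding hom_dx_dx_def hom_dx_dy_def hom_dy_dy_def hom_radial_def Let_def F_def[symmetric] W
    by algebra
qed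

lemma projective_form_times_height:
  assumes "n \<ge> 2"
  shows "p$3 * projective_form f n p X =
      hom_dx_dx f n (p$1) (p$2) (p$3) * (p$3 * X$1 - p$1 * X$3)^2
      + hom_dx_dy f n (p$1) (p$2) (p$3) * ((p$3 * X$1 - p$1 * X$3) * (p$3 * X$2 - p$2 * X$3))
      + hom_dy_dy f n (p$1) (p$2) (p$3) * (p$3 * X$2 - p$2 * X$3)^2"
  using radial_value_eq[OF assms, of f "p$1" "p$2" "p$3"]
  unfolding projective_form_def Let_def by algebra

text \<open>
  Central projection to the plane \<open>w = 1\<close>. It inverts both \<open>s1\<close> and \<open>s2\<close>; \<open>foot_deriv\<close> is its
  differential.
\<close>

definition foot :: "real^3 \<Rightarrow> real^2" where
  "foot q = vector [q$1 / q$3, q$2 / q$3]"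

definition foot_deriv :: "real^3 \<Rightarrow> real^3 \<Rightarrow> real^2" where
  "foot_deriv q X =
    vector [(q$3 * X$1 - q$1 * X$3) / (q$3)^2, (q$3 * X$2 - q$2 * X$3) / (q$3)^2]"

lemma projective_form_eq_principal_form:
  assumes f: "total_degree f \<le> n" and n: "n \<ge> 2" and w: "q$3 \<noteq> 0"
  shows "q$3 * projective_form f n q X = (q$3) ^ (3 * n) * principal_form f (foot q) (foot_deriv q X)"
proof -
  obtain m where m: "n = m + 2" using n by (metis add.commute le_Suc_ex)
  \<comment> \<open>With \<open>z\<close> for the power of symbolic exponent, the claim is a polynomial identity.\<close>
  define z where "z = (q$3) ^ m"
  define D where "D a b = eval2 ((d_y ^^ b) ((d_x ^^ a) f)) (foot q $ 1) (foot q $ 2)" for a b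
  have "hom_partial f n a b 0 (q$1) (q$2) (q$3) = (q$3) ^ (n - a - b) * D a b" if "a + b \<le> n" for a b
    using hom_partial_eq_eval2[OF f that w] by (simp add: D_def foot_def)
  note this[of 1 0] this[of 0 1] this[of 2 0] this[of 1 1] this[of 0 2]
  then have F: "hom_partial f n 1 0 0 (q$1) (q$2) (q$3) = z * q$3 * D 1 0"
    "hom_partial f n 0 1 0 (q$1) (q$2) (q$3) = z * q$3 * D 0 1"
    "hom_partial f n 2 0 0 (q$1) (q$2) (q$3) = z * D 2 0"
    "hom_partial f n 1 1 0 (q$1) (q$2) (q$3) = z * D 1 1"
    "hom_partial f n 0 2 0 (q$1) (q$2) (q$3) = z * D 0 2"
    by (simp_all add: m z_def)
  have exponents: "2 * n - 2 = m * 2 + 2" "3 * n = m * 3 + 6" by (simp_all add: m)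
  have W: "(q$3) ^ (2 * n - 2) = z^2 * (q$3)^2" "(q$3) ^ (3 * n) = z^3 * (q$3)^6"
    by (simp_all only: exponents z_def power_add power_mult)
  have P: "principal_form f (foot q) X =
      (D 1 1 + D 1 1 * (D 1 0)^2 - D 1 0 * D 0 1 * D 2 0) * (X$1)^2
      + (D 0 2 * (1 + (D 1 0)^2) - D 2 0 * (1 + (D 0 1)^2)) * (X$1 * X$2)
      + (D 1 0 * D 0 1 * D 0 2 - D 1 1 - D 1 1 * (D 0 1)^2) * (X$2)^2" for X
    by (simp add: principal_form_def D_def Let_def numeral_2_eq_2)
  have "q$3 * X$1 - q$1 * X$3 = (q$3)^2 * foot_deriv q X $ 1"
    "q$3 * X$2 - q$2 * X$3 = (q$3)^2 * foot_deriv q X $ 2"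
    using w by (simp_all add: foot_deriv_def)
  then show ?thesis
    unfolding projective_form_times_height[OF n] hom_dx_dx_def hom_dx_dy_def hom_dy_dy_def Let_def
      F W P
    by algebra
qed

lemma projective_form_scale: "projective_form f n q (r *\<^sub>R X) = r^2 * projective_form f n q X"
  unfolding projective_form_def Let_def vector_scaleR_component real_scaleR_def by algebra

lemma real_polynomial_function_hom_coefficients:
  "real_polynomial_function (\<lambda>p :: real^3. hom_dx_dx f n (p$1) (p$2) (p$3))"
  "real_polynomial_function (\<lambda>p :: real^3. hom_dx_dy f n (p$1) (p$2) (p$3))"
  "real_polynomial_function (\<lambda>p :: real^3. hom_dy_dy f n (p$1) (p$2) (p$3))"
  "real_polynomial_function (\<lambda>p :: real^3. hom_radial f n (p$1) (p$2) (p$3))"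
  unfolding hom_dx_dx_def hom_dx_dy_def hom_dy_dy_def hom_radial_def Let_def
  by (intro real_polynomial_function.intros(2-4) real_polynomial_function_diff
      real_polynomial_function_power real_polynomial_function_coordinate
      real_polynomial_function_hom_partial)+

lemma analytic_projective_form: "analytic_quadratic_form (projective_form f n)"
proof -
  define A B C E where
    "A p = hom_dx_dx f n (p$1) (p$2) (p$3)" and "B p = hom_dx_dy f n (p$1) (p$2) (p$3)" and
    "C p = hom_dy_dy f n (p$1) (p$2) (p$3)" and "E p = hom_radial f n (p$1) (p$2) (p$3)"
  for p :: "real^3"
  \<comment> \<open>The coefficients need not be symmetric: each mixed term is put in one place only.\<close>
  define a :: "3 \<Rightarrow> 3 \<Rightarrow> real^3 \<Rightarrow> real" where
    "a i j p =
      (if i = 1 \<and> j = 1 then p$3 * A p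
       else if i = 1 \<and> j = 2 then p$3 * B p
       else if i = 2 \<and> j = 2 then p$3 * C p
       else if i = 3 \<and> j = 1 then - (2 * A p * p$1 + B p * p$2)
       else if i = 3 \<and> j = 2 then - (B p * p$1 + 2 * C p * p$2)
       else if i = 3 \<and> j = 3 then E p else 0)" for i j p
  note pf = real_polynomial_function_hom_coefficients[of f n, folded A_def B_def C_def E_def]
  have "real_polynomial_function (a i j)" for i j
    unfolding a_def[abs_def]
    using exhaust_3[of i] exhaust_3[of j]
    by (auto intro!: pf real_polynomial_function.intros(2-4) real_polynomial_function_minus
        real_polynomial_function_coordinate)
  moreover have "projective_form f n q X = (\<Sum>i\<in>UNIV. \<Sum>j\<in>UNIV. a i j q * X$i * X$j)" for q X
    by (simp add: sum_3 a_def projective_form_def Let_def A_def B_def C_def E_def power2_eq_square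
        algebra_simps)
  ultimately show ?thesis
    unfolding analytic_quadratic_form_def
    by (intro ballI exI[of _ UNIV] exI[of _ a]) (auto intro: real_polynomial_function_imp_real_analytic_on)
qed


section \<open>Transport by the Poincare projections\<close>

lemma inner_3: "(p :: real^3) \<bullet> X = p$1 * X$1 + p$2 * X$2 + p$3 * X$3"
  by (simp add: inner_vec_def sum_3)

lemma mem_S2_iff: "p \<in> S2 \<longleftrightarrow> (p$1)^2 + (p$2)^2 + (p$3)^2 = 1"
  by (simp add: norm_eq_sqrt_inner inner_3 power2_eq_square)

definition s1_deriv :: "real^2 \<Rightarrow> real^2 \<Rightarrow> real^3" where
  "s1_deriv p h = (let r = 1 / sqrt (1 + (p$1)^2 + (p$2)^2); d = - (r^3) * (p$1 * h$1 + p$2 * h$2)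
     in vector [d * p$1 + r * h$1, d * p$2 + r * h$2, d])"

lemma s1_nth:
  "s1 p $ 1 = p$1 / sqrt (1 + (p$1)^2 + (p$2)^2)"
  "s1 p $ 2 = p$2 / sqrt (1 + (p$1)^2 + (p$2)^2)"
  "s1 p $ 3 = 1 / sqrt (1 + (p$1)^2 + (p$2)^2)"
  by (simp_all add: s1_def)

lemma one_plus_squares_pos: "1 + (x::real)^2 + y^2 > 0"
  by (simp add: add_pos_nonneg)

lemma has_derivative_s1: "(s1 has_derivative s1_deriv p) (at p)"
proof -
  define R where "R p = 1 / sqrt (1 + (p$1)^2 + (p$2)^2)" for p :: "real^2"
  have pos: "1 + (p$1)^2 + (p$2)^2 > 0" by (rule one_plus_squares_pos)
  have c: "((\<lambda>p. p$i) has_derivative (\<lambda>h. h$i)) (at p)" for i :: 2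
    by (intro bounded_linear.has_derivative[OF bounded_linear_vec_nth] has_derivative_ident)
  have R: "(R has_derivative (\<lambda>h. - (R p ^ 3) * (p$1 * h$1 + p$2 * h$2))) (at p)"
  proof -
    have "((\<lambda>p. 1 / sqrt (1 + (p$1)^2 + (p$2)^2)) has_derivative
       (\<lambda>h. - (2 * p$1 * h$1 + 2 * p$2 * h$2) / (2 * sqrt (1 + (p$1)^2 + (p$2)^2)) *
         (R p)^2)) (at p)"
      by (rule derivative_eq_intros c refl | use pos in \<open>simp add: R_def fun_eq_iff field_simps power2_eq_square\<close>)+
    moreover have "- (2 * x + 2 * y) / (2 * S) * (1 / S)^2 = - ((1 / S) ^ 3) * (x + y)" for x y S :: real
      by (simp add: divide_simps power2_eq_square power3_eq_cube)
    ultimately show ?thesis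
      unfolding R_def[abs_def] by (simp only: mult.assoc)
  qed
  have "((\<lambda>p. s1 p $ i) has_derivative (\<lambda>h. s1_deriv p h $ i)) (at p)" for i
  proof -
    have "((\<lambda>p. R p * p$1) has_derivative (\<lambda>h. s1_deriv p h $ 1)) (at p)"
      "((\<lambda>p. R p * p$2) has_derivative (\<lambda>h. s1_deriv p h $ 2)) (at p)"
      "((\<lambda>p. R p) has_derivative (\<lambda>h. s1_deriv p h $ 3)) (at p)"
      by (rule has_derivative_eq_rhs, (rule R c has_derivative_mult)+,
          simp add: s1_deriv_def Let_def R_def fun_eq_iff)+
    then show ?thesis
      using exhaust_3[of i] by (auto simp: s1_def R_def)
  qed
  then show ?thesis
    unfolding has_derivative_componentwise_within[of s1]
    by (auto simp: Basis_vec_def inner_axis)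
qed

lemma inj_s1: "inj s1"
proof (rule injI)
  fix p p' assume "s1 p = s1 p'"
  moreover have "p = foot (s1 p)" for p
    using one_plus_squares_pos[of "p$1" "p$2"]
    by (simp add: vec_eq_iff forall_2 foot_def s1_nth)
  ultimately show "p = p'" by metis
qed

lemma s1_foot:
  assumes "q \<in> upper_hemisphere"
  shows "s1 (foot q) = q"
proof -
  have q: "(q$1)^2 + (q$2)^2 + (q$3)^2 = 1" "q$3 > 0"
    using assms by (simp_all only: upper_hemisphere_def mem_Collect_eq mem_S2_iff)
  then have "1 + (q$1 / q$3)^2 + (q$2 / q$3)^2 = (1 / q$3)^2"
    by (simp add: field_simps)
  with q show ?thesis
    by (simp add: vec_eq_iff forall_3 s1_nth foot_def)
qed

lemma inj_s1_deriv: "inj (s1_deriv p)"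
proof (rule injI)
  fix h k assume "s1_deriv p h = s1_deriv p k"
  moreover have "1 / sqrt (1 + (p$1)^2 + (p$2)^2) \<noteq> 0"
    using one_plus_squares_pos[of "p$1" "p$2"] by simp
  ultimately show "h = k"
    unfolding s1_deriv_def Let_def by (auto simp: vec_eq_iff forall_2 forall_3)
qed

lemma s1_deriv_foot_deriv:
  assumes "q \<in> upper_hemisphere" and "X \<in> tangent_space q"
  shows "s1_deriv (foot q) (foot_deriv q X) = X"
proof -
  have q: "(q$1)^2 + (q$2)^2 + (q$3)^2 = 1" "q$3 > 0"
    using assms by (simp_all only: upper_hemisphere_def mem_Collect_eq mem_S2_iff)
  have X: "q$1 * X$1 + q$2 * X$2 + q$3 * X$3 = 0"
    using assms by (simp add: tangent_space_def inner_3)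
  define d where "d = - ((q$3)^3) * (foot q $ 1 * foot_deriv q X $ 1 + foot q $ 2 * foot_deriv q X $ 2)"
  have R: "1 / sqrt (1 + (foot q $ 1)^2 + (foot q $ 2)^2) = q$3"
    using s1_foot[OF assms(1)] s1_nth(3)[of "foot q"] by simp
  have "d = - (q$1 * (q$3 * X$1 - q$1 * X$3) + q$2 * (q$3 * X$2 - q$2 * X$3))"
    using q(2) by (simp add: d_def foot_def foot_deriv_def field_simps power2_eq_square power3_eq_cube)
  also have "\<dots> = X$3"
    using q(1) X by algebra
  finally have "d = X$3" .
  with q(2) show ?thesis
    unfolding s1_deriv_def R Let_def d_def[symmetric]
    by (simp add: vec_eq_iff forall_3 foot_def foot_deriv_def field_simps power2_eq_square)
qed

lemma induced_form_s1:
  assumes "q \<in> upper_hemisphere" and "X \<in> tangent_space q"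
  shows "induced_form s1 \<eta> q X = \<eta> (foot q) (foot_deriv q X)"
proof -
  have "inv s1 q = foot q"
    by (rule inv_f_eq[OF inj_s1 s1_foot[OF assms(1)]])
  moreover have "frechet_derivative s1 (at p) = s1_deriv p" for p
    by (rule frechet_derivative_at[OF has_derivative_s1, symmetric])
  moreover have "inv (s1_deriv (foot q)) X = foot_deriv q X"
    by (rule inv_f_eq[OF inj_s1_deriv s1_deriv_foot_deriv[OF assms]])
  ultimately show ?thesis
    by (simp add: induced_form_def)
qed

text \<open>
  The antipodal map interchanges the two projections, which reduces the lower hemisphere to the
  upper one.
\<close>

lemma induced_form_s2: "induced_form s2 \<eta> q X = induced_form s1 \<eta> (- q) (- X)"
proof -
  have s2: "s2 = (\<lambda>p. - s1 p)"
    by (simp add: fun_eq_iff s1_def s2_def)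
  have "frechet_derivative s2 (at p) = (\<lambda>h. - s1_deriv p h)" for p
    unfolding s2 by (rule frechet_derivative_at[OF has_derivative_minus[OF has_derivative_s1], symmetric])
  moreover have "frechet_derivative s1 (at p) = s1_deriv p" for p
    by (rule frechet_derivative_at[OF has_derivative_s1, symmetric])
  moreover have "inv (\<lambda>p. - g p) y = inv g (- y)" for g :: "real^2 \<Rightarrow> real^3" and y
  proof -
    have "(- g x = y) \<longleftrightarrow> (g x = - y)" for x by auto
    then show ?thesis by (simp only: inv_def)
  qed
  ultimately show ?thesis
    by (simp add: induced_form_def s2)
qed

lemma zero_locus_upper:
  assumes "total_degree f \<le> n" and "n \<ge> 2" and "q \<in> upper_hemisphere"
  shows "zero_locus (projective_form f n) q = zero_locus (induced_form s1 (principal_form f)) q"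
proof -
  have w: "q$3 \<noteq> 0" using assms(3) by (simp add: upper_hemisphere_def)
  have "projective_form f n q X = 0 \<longleftrightarrow> induced_form s1 (principal_form f) q X = 0"
    if "X \<in> tangent_space q" for X
    using projective_form_eq_principal_form[OF assms(1,2) w, of X] w induced_form_s1[OF assms(3) that]
    by (metis mult_eq_0_iff power_not_zero)
  then show ?thesis
    by (auto simp: zero_locus_def)
qed

lemma zero_locus_lower:
  assumes "total_degree f \<le> n" and "n \<ge> 2" and "q \<in> lower_hemisphere"
  shows "zero_locus (projective_form f n) q = zero_locus (induced_form s2 (principal_form f)) q"
proof -
  have w: "q$3 \<noteq> 0" and upper: "- q \<in> upper_hemisphere"
    using assms(3) by (auto simp: lower_hemisphere_def upper_hemisphere_def)
  have foot: "foot (- q) = foot q" "foot_deriv (- q) (- X) = foot_deriv q X" for X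
    by (simp_all add: foot_def foot_deriv_def)
  have "projective_form f n q X = 0 \<longleftrightarrow> induced_form s2 (principal_form f) q X = 0"
    if "X \<in> tangent_space q" for X
  proof -
    have "- X \<in> tangent_space (- q)" using that by (simp add: tangent_space_def)
    then have "induced_form s2 (principal_form f) q X = principal_form f (foot q) (foot_deriv q X)"
      by (simp add: induced_form_s2 induced_form_s1[OF upper] foot)
    then show ?thesis
      using projective_form_eq_principal_form[OF assms(1,2) w, of X] w
      by (metis mult_eq_0_iff power_not_zero)
  qed
  then show ?thesis
    by (auto simp: zero_locus_def)
qed


section \<open>Principal directions are real\<close>

lemma binary_quadratic_form_has_zero:
  fixes A B C :: real
  assumes "4 * A * C \<le> B^2"
  obtains x y where "(x, y) \<noteq> (0, 0)" "A * x^2 + B * (x * y) + C * y^2 = 0"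
proof (cases "A = 0")
  case True
  then show ?thesis using that[of 1 0] by simp
next
  case False
  define D where "D = sqrt (B^2 - 4 * A * C)"
  have D: "D^2 = B^2 - 4 * A * C" using assms by (simp add: D_def)
  have "A * (D - B)^2 + B * ((D - B) * (2 * A)) + C * (2 * A)^2 = 0"
    using D by algebra
  then show ?thesis using that[of "D - B" "2 * A"] False by simp
qed

text \<open>
  With respect to the first fundamental form \<open>(1 + p\<^sup>2, pq, 1 + q\<^sup>2)\<close> the form of principal
  directions has trace zero. Being trace-free for a positive definite form forces a nonnegative
  discriminant.
\<close>

lemma principal_form_discriminant:
  fixes p q r s t :: real
  defines "A \<equiv> s + s * p^2 - p * q * r"
    and "B \<equiv> t * (1 + p^2) - r * (1 + q^2)"
    and "C \<equiv> p * q * t - s - s * q^2"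
  shows "4 * A * C \<le> B^2"
proof -
  \<comment> \<open>Complete the square in \<open>B\<close>, eliminating \<open>C\<close> by the trace condition
     \<open>(1 + q\<^sup>2) A - p q B + (1 + p\<^sup>2) C = 0\<close>; the determinant of the first fundamental form
     is \<open>1 + p\<^sup>2 + q\<^sup>2\<close>.\<close>
  have "(1 + p^2)^2 * (B^2 - 4 * A * C) =
      ((1 + p^2) * B - 2 * (p * q) * A)^2 + 4 * A^2 * (1 + p^2 + q^2)"
    unfolding A_def B_def C_def by algebra
  also have "\<dots> \<ge> 0" by (intro add_nonneg_nonneg mult_nonneg_nonneg) auto
  finally have "(1 + p^2)^2 * (B^2 - 4 * A * C) \<ge> 0" .
  moreover have "1 + p^2 > 0" by (simp add: add_pos_nonneg)
  then have "(1 + p^2)^2 > 0" by simp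
  ultimately show ?thesis by (simp add: zero_le_mult_iff)
qed

lemma projective_form_has_zero_direction:
  assumes f: "total_degree f \<le> n" and n: "n \<ge> 2" and q: "q \<in> S2" and w: "q$3 \<noteq> 0"
  obtains X where "X \<noteq> 0" "X \<in> zero_locus (projective_form f n) q"
proof -
  obtain x y where xy: "(x, y) \<noteq> (0, 0)"
    and zero: "principal_form f (foot q) (vector [x, y]) = 0"
    unfolding principal_form_def Let_def vector_2
    by (rule binary_quadratic_form_has_zero[OF principal_form_discriminant]) blast
  \<comment> \<open>\<open>X\<close> is the tangent vector that \<open>foot_deriv q\<close> maps to \<open>(x, y)\<close>.\<close>
  define c where "c = - ((q$3)^2 * (q$1 * x + q$2 * y))"
  define X :: "real^3" where
    "X = vector [((q$3)^2 * x + q$1 * c) / q$3, ((q$3)^2 * y + q$2 * c) / q$3, c]"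
  have "q$3 * (q \<bullet> X) = (q$3)^2 * (q$1 * x + q$2 * y) + ((q$1)^2 + (q$2)^2 + (q$3)^2) * c"
    using w by (simp add: X_def inner_3 field_simps power2_eq_square)
  also have "\<dots> = 0"
    using q by (simp only: mem_S2_iff c_def)
  finally have tangent: "X \<in> tangent_space q"
    using w by (simp add: tangent_space_def)
  have deriv: "foot_deriv q X = vector [x, y]"
    using w by (simp add: foot_deriv_def X_def)
  have "X \<noteq> 0"
  proof
    assume "X = 0"
    then show False using xy deriv by (simp add: foot_deriv_def vec_eq_iff forall_2)
  qed
  moreover have "projective_form f n q X = 0"
    using projective_form_eq_principal_form[OF f n w, of X] w by (simp add: deriv zero)
  ultimately show ?thesis
    using that tangent by (auto simp: zero_locus_def)
qed


section \<open>The form along the equator\<close>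

text \<open>
  The dehomogenization \<open>h(y) = f\<^sub>n(1, y)\<close> of the homogeneous part of degree \<open>n\<close>.
\<close>

definition top_polynomial :: "real poly poly \<Rightarrow> nat \<Rightarrow> real poly" where
  "top_polynomial f n = (\<Sum>j\<le>n. monom (coeff (coeff f j) (n - j)) j)"

lemma coeff_top_polynomial:
  "coeff (top_polynomial f n) j = (if j \<le> n then coeff (coeff f j) (n - j) else 0)"
  by (simp add: top_polynomial_def coeff_sum)

lemma poly_top_polynomial: "poly (top_polynomial f n) y = hom_partial f n 0 0 0 1 y 0"
proof -
  have "hom_partial f n 0 0 0 1 y 0 =
      (\<Sum>i\<le>n. \<Sum>j\<le>n - i. if j = n - i then coeff (coeff f j) i * y ^ j else 0)"
    unfolding hom_partial_def by (intro sum.cong) auto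
  also have "\<dots> = (\<Sum>i\<le>n. coeff (coeff f (n - i)) i * y ^ (n - i))"
    by simp
  also have "\<dots> = (\<Sum>j\<le>n. coeff (coeff f j) (n - j) * y ^ j)"
    by (rule sum.reindex_bij_witness[of _ "\<lambda>j. n - j" "\<lambda>j. n - j"]) auto
  finally show ?thesis
    by (simp add: top_polynomial_def poly_sum poly_monom)
qed

lemma poly_pderiv_top_polynomial:
  "poly (pderiv (top_polynomial f n)) y = hom_partial f n 0 1 0 1 y 0"
  "poly (pderiv (pderiv (top_polynomial f n))) y = hom_partial f n 0 2 0 1 y 0"
proof -
  have 1: "poly (pderiv (top_polynomial f n)) y = hom_partial f n 0 1 0 1 y 0" for y
    using DERIV_hom_partial_v[of f n 0 0 0 1 0 y] poly_DERIV[of "top_polynomial f n" y]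
    unfolding poly_top_polynomial[abs_def] One_nat_def by (rule DERIV_unique[rotated])
  then show "poly (pderiv (top_polynomial f n)) y = hom_partial f n 0 1 0 1 y 0" .
  show "poly (pderiv (pderiv (top_polynomial f n))) y = hom_partial f n 0 2 0 1 y 0"
    using DERIV_hom_partial_v[of f n 0 1 0 1 0 y] poly_DERIV[of "pderiv (top_polynomial f n)" y]
    unfolding 1[abs_def] numeral_2_eq_2 One_nat_def by (rule DERIV_unique[rotated])
qed

lemma hom_coefficients_scale:
  assumes "n \<ge> 1"
  shows "t ^ 4 * hom_dx_dx f n (t * u) (t * v) (t * w) = t ^ (3 * n) * hom_dx_dx f n u v w"
    and "t ^ 4 * hom_dx_dy f n (t * u) (t * v) (t * w) = t ^ (3 * n) * hom_dx_dy f n u v w"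
    and "t ^ 4 * hom_dy_dy f n (t * u) (t * v) (t * w) = t ^ (3 * n) * hom_dy_dy f n u v w"
proof -
  define z where "z = t ^ n"
  define F G where "F a b = hom_partial f n a b 0 (t * u) (t * v) (t * w)"
    and "G a b = hom_partial f n a b 0 u v w" for a b
  have "t ^ (a + b) * F a b = z * G a b" for a b
    using hom_partial_scale[of t a b 0 f n u v w] by (simp add: F_def G_def z_def)
  note this[of 1 0] this[of 0 1] this[of 2 0] this[of 1 1] this[of 0 2]
  then have F: "t * F 1 0 = z * G 1 0" "t * F 0 1 = z * G 0 1" "t^2 * F 2 0 = z * G 2 0"
    "t^2 * F 1 1 = z * G 1 1" "t^2 * F 0 2 = z * G 0 2"
    by (simp_all add: numeral_2_eq_2)
  have "2 * n = 2 + (2 * n - 2)" using assms by simp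
  then have "z^2 = t^2 * t ^ (2 * n - 2)"
    unfolding z_def by (metis power_add power_mult mult.commute)
  then have W: "t^2 * (t * w) ^ (2 * n - 2) = z^2 * w ^ (2 * n - 2)"
    by (simp add: power_mult_distrib)
  have Z: "t ^ (3 * n) = z^3" by (simp add: z_def power_mult[symmetric] mult.commute)
  define V V' where "V = (t * w) ^ (2 * n - 2)" and "V' = w ^ (2 * n - 2)"
  note W = W[folded V_def V'_def]
  note defs = Let_def F_def[symmetric] G_def[symmetric] V_def[symmetric] V'_def[symmetric] Z
  have "t ^ 4 * hom_dx_dx f n (t * u) (t * v) (t * w) =
      (t^2 * V) * (t^2 * F 1 1) + (t^2 * F 1 1) * (t * F 1 0)^2 - (t * F 1 0) * (t * F 0 1) * (t^2 * F 2 0)"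
    unfolding hom_dx_dx_def defs by algebra
  then show "t ^ 4 * hom_dx_dx f n (t * u) (t * v) (t * w) = t ^ (3 * n) * hom_dx_dx f n u v w"
    unfolding hom_dx_dx_def defs F W by algebra
  have "t ^ 4 * hom_dx_dy f n (t * u) (t * v) (t * w) =
      (t^2 * F 0 2) * (t^2 * V + (t * F 1 0)^2) - (t^2 * F 2 0) * (t^2 * V + (t * F 0 1)^2)"
    unfolding hom_dx_dy_def defs by algebra
  then show "t ^ 4 * hom_dx_dy f n (t * u) (t * v) (t * w) = t ^ (3 * n) * hom_dx_dy f n u v w"
    unfolding hom_dx_dy_def defs F W by algebra
  have "t ^ 4 * hom_dy_dy f n (t * u) (t * v) (t * w) =
      (t * F 1 0) * (t * F 0 1) * (t^2 * F 0 2) - (t^2 * V) * (t^2 * F 1 1) - (t^2 * F 1 1) * (t * F 0 1)^2"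
    unfolding hom_dy_dy_def defs by algebra
  then show "t ^ 4 * hom_dy_dy f n (t * u) (t * v) (t * w) = t ^ (3 * n) * hom_dy_dy f n u v w"
    unfolding hom_dy_dy_def defs F W by algebra
qed

text \<open>
  Minus twice the polar form of \<open>A dx\<^sup>2 + B dx dy + C dy\<^sup>2\<close> at the radial vector \<open>(u, v)\<close> and
  the tangent vector \<open>(- v, u)\<close>. On the unit circle this is the coefficient of \<open>projective_form\<close>
  for the product of \<open>dw\<close> and \<open>u dv - v du\<close>.
\<close>

definition equator_mixed :: "real poly poly \<Rightarrow> nat \<Rightarrow> real \<Rightarrow> real \<Rightarrow> real" where
  "equator_mixed f n u v =
    2 * hom_dx_dx f n u v 0 * u * v + hom_dx_dy f n u v 0 * (v^2 - u^2) - 2 * hom_dy_dy f n u v 0 * u * v"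

text \<open>
  Write \<open>r = (1, y)\<close>, \<open>t = (- y, 1)\<close> and let \<open>g\<close> be the homogeneous part of degree \<open>n\<close>, with
  Hessian matrix \<open>H\<close>. Twice the polar form of \<open>X \<mapsto> dg(X) det(\<nabla>g, H X)\<close> at \<open>r\<close> and \<open>t\<close> is
  \<open>dg(r) det(\<nabla>g, H t) + dg(t) det(\<nabla>g, H r)\<close>. The second term vanishes because \<open>H r\<close> is a
  multiple of \<open>\<nabla>g\<close>, and \<open>dg(r) = n g\<close>. The remaining determinant is evaluated by Euler's
  identity, which expresses the derivatives of \<open>g\<close> through those of \<open>h\<close>.
\<close>

lemma equator_mixed_eq_hessian:
  fixes f :: "real poly poly"
  assumes n: "n \<ge> 2"
  defines "h \<equiv> top_polynomial f n"
  shows "equator_mixed f n 1 y = - real n * (1 + y^2) *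
      poly (h * (smult (real n) (h * pderiv (pderiv h)) - smult (real n - 1) ((pderiv h)^2))) y"
proof -
  define F where "F a b = hom_partial f n a b 0 1 y 0" for a b
  have W: "(0::real) ^ (2 * n - 2) = 0" using n by simp
  have x: "F 1 0 + y * F 0 1 = n * F 0 0"
    using hom_partial_euler[of 1 f n 0 0 0 y 0] by (simp add: F_def)
  have xx: "F 2 0 + y * F 1 1 = (real n - 1) * F 1 0"
    using hom_partial_euler[of 1 f n 1 0 0 y 0] by (simp add: F_def numeral_2_eq_2)
  have xy: "F 1 1 + y * F 0 2 = (real n - 1) * F 0 1"
    using hom_partial_euler[of 1 f n 0 1 0 y 0] by (simp add: F_def numeral_2_eq_2)
  define H where "H = real n * (F 0 0 * F 0 2) - (real n - 1) * (F 0 1)^2"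
  define d where "d = F 1 0 * (F 0 2 - y * F 1 1) - F 0 1 * (F 1 1 - y * F 2 0)"
  have "equator_mixed f n 1 y = - (F 1 0 + y * F 0 1) * d
        - (F 0 1 - y * F 1 0) * (F 1 0 * (F 1 1 + y * F 0 2) - F 0 1 * (F 2 0 + y * F 1 1))"
    unfolding equator_mixed_def power_one mult_1_right hom_dx_dx_def hom_dx_dy_def
      hom_dy_dy_def Let_def W F_def[symmetric] d_def by algebra
  also have "\<dots> = - (real n * F 0 0) * d"
    unfolding x xx xy by algebra
  also have "d = (1 + y^2) * H"
  proof -
    have 1: "F 1 0 * F 0 2 - F 0 1 * F 1 1 = H"
      using x xy unfolding H_def by algebra
    have 2: "F 0 1 * F 2 0 - F 1 0 * F 1 1 = y * H"
      using x xx xy unfolding H_def by algebra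
    have "d = (F 1 0 * F 0 2 - F 0 1 * F 1 1) + y * (F 0 1 * F 2 0 - F 1 0 * F 1 1)"
      unfolding d_def by algebra
    then show ?thesis unfolding 1 2 by algebra
  qed
  finally show ?thesis
    unfolding h_def poly_mult poly_diff poly_smult poly_power poly_top_polynomial
      poly_pderiv_top_polynomial F_def[symmetric] H_def by simp
qed

lemma equator_nth [simp]: "equator t $ 1 = cos t" "equator t $ 2 = sin t" "equator t $ 3 = 0"
  by (simp_all add: equator_def)

lemma equator_mem_S2: "equator t \<in> S2"
  using range_equator by blast

lemma equator_singular_iff:
  "equator t \<in> singular_points (projective_form f n) \<longleftrightarrow>
    equator_mixed f n (cos t) (sin t) = 0 \<and> hom_radial f n (cos t) (sin t) 0 = 0"
proof -
  have 1: "(cos t)^2 + (sin t)^2 = 1" by simp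
  have on_tangent: "projective_form f n (equator t) X =
      (X$3)^2 * hom_radial f n (cos t) (sin t) 0 +
      X$3 * (cos t * X$2 - sin t * X$1) * equator_mixed f n (cos t) (sin t)"
    if "X \<in> tangent_space (equator t)" for X
  proof -
    have "cos t * X$1 + sin t * X$2 = 0"
      using that by (simp add: tangent_space_def inner_3)
    then have "X$1 = - (cos t * X$2 - sin t * X$1) * sin t" "X$2 = (cos t * X$2 - sin t * X$1) * cos t"
      using 1 by algebra+
    then show ?thesis
      unfolding projective_form_def equator_mixed_def Let_def equator_nth by algebra
  qed
  have tangent: "vector [- sin t, cos t, 1] \<in> tangent_space (equator t)"
    "vector [0, 0, 1] \<in> tangent_space (equator t)"
    by (simp_all add: tangent_space_def inner_3)
  show ?thesis
  proof
    assume "equator t \<in> singular_points (projective_form f n)"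
    then have "projective_form f n (equator t) X = 0" if "X \<in> tangent_space (equator t)" for X
      using that by (auto simp: singular_points_def)
    from this[OF tangent(1)] this[OF tangent(2)]
    show "equator_mixed f n (cos t) (sin t) = 0 \<and> hom_radial f n (cos t) (sin t) 0 = 0"
      using on_tangent[OF tangent(1)] on_tangent[OF tangent(2)] 1 by (simp add: power2_eq_square)
  next
    assume "equator_mixed f n (cos t) (sin t) = 0 \<and> hom_radial f n (cos t) (sin t) 0 = 0"
    then show "equator t \<in> singular_points (projective_form f n)"
      using equator_mem_S2 by (simp add: singular_points_def on_tangent)
  qed
qed

lemma open_equator_nonsingular:
  "open {t. equator t \<notin> singular_points (projective_form f n)}"
proof -
  have eq: "continuous_on UNIV equator"
    unfolding continuous_on_componentwise[of UNIV equator]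
    by (auto simp: Basis_vec_def inner_axis equator_def forall_3 intro!: continuous_intros)
  have cont: "continuous_on UNIV (\<lambda>t. g (equator t))" if "real_polynomial_function g" for g
    using that
    by (intro continuous_on_compose2[OF _ eq, of UNIV] continuous_on_polymonial_function)
       (auto simp: real_polynomial_function_eq)
  note C = real_polynomial_function_hom_coefficients[of f n, THEN cont, simplified]
  have "open ({t. equator_mixed f n (cos t) (sin t) \<noteq> 0} \<union> {t. hom_radial f n (cos t) (sin t) 0 \<noteq> 0})"
    unfolding equator_mixed_def
    by (intro open_Un open_Collect_neq continuous_intros C)
  also have "{t. equator_mixed f n (cos t) (sin t) \<noteq> 0} \<union> {t. hom_radial f n (cos t) (sin t) 0 \<noteq> 0}
      = {t. equator t \<notin> singular_points (projective_form f n)}"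
    by (auto simp: equator_singular_iff)
  finally show ?thesis .
qed

lemma equator_mixed_scale:
  assumes "n \<ge> 1"
  shows "r ^ 4 * equator_mixed f n (r * u) (r * v) = r ^ (3 * n) * r^2 * equator_mixed f n u v"
proof -
  define z where "z = r ^ (3 * n)"
  show ?thesis
    using hom_coefficients_scale[OF assms, of r f u v 0]
    unfolding equator_mixed_def mult_zero_right z_def[symmetric] by algebra
qed


section \<open>Binary forms with vanishing Hessian\<close>

text \<open>
  Compare the leading coefficients: differentiation multiplies them by the degree.
\<close>

lemma degree_eq_of_wronskian_eq_0:
  fixes p q :: "real poly"
  assumes "pderiv q * p = q * pderiv p" and "p \<noteq> 0" and "q \<noteq> 0"
  shows "degree q = degree p"
proof -
  have lead: "coeff (pderiv r) (degree r - 1) = of_nat (degree r) * lead_coeff r" for r :: "real poly"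
    by (cases "degree r") (auto simp: coeff_pderiv coeff_eq_0)
  have lead: "lead_coeff (pderiv r) = of_nat (degree r) * lead_coeff r" for r :: "real poly"
    using lead[of r] by (simp add: degree_pderiv)
  show ?thesis
    using arg_cong[OF assms(1), of lead_coeff] assms(2,3) by (simp add: lead_coeff_mult lead)
qed

lemma proportional_of_wronskian_eq_0:
  fixes p q :: "real poly"
  assumes W: "pderiv q * p = q * pderiv p" and p: "p \<noteq> 0"
  obtains c where "q = smult c p"
proof (cases "q = 0")
  case True
  then show ?thesis using that[of 0] by simp
next
  case False
  define c where "c = lead_coeff q / lead_coeff p"
  define d where "d = q - smult c p"
  have deg: "degree q = degree p"
    by (rule degree_eq_of_wronskian_eq_0[OF W p False])
  have "pderiv d * p = d * pderiv p"
    using W by (simp add: d_def pderiv_diff pderiv_smult algebra_simps)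
  moreover have "coeff d (degree p) = 0"
    using p deg by (simp add: d_def c_def)
  ultimately have "d = 0"
    using degree_eq_of_wronskian_eq_0[OF _ p, of d] by (metis leading_coeff_0_iff)
  then show ?thesis using that[of c] by (simp add: d_def)
qed

text \<open>
  The equation says that the Wronskian of \<open>n h - y h'\<close> and \<open>h'\<close> vanishes. So \<open>n h = (y - s) h'\<close>
  for some \<open>s\<close>, and differentiation gives \<open>(n - 1) h' = (y - s) h''\<close>.
\<close>

lemma double_root_of_hessian_eq_0:
  fixes h :: "real poly"
  assumes hess: "smult (real n) (h * pderiv (pderiv h)) = smult (real n - 1) ((pderiv h)^2)"
    and n: "n \<ge> 2" and h': "pderiv h \<noteq> 0"
  obtains s k where "h = [:-s, 1:]^2 * k"
proof -
  define q where "q = smult (real n) h - [:0, 1:] * pderiv h"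
  have q': "pderiv q = smult (real n - 1) (pderiv h) - [:0, 1:] * pderiv (pderiv h)"
    by (simp add: q_def pderiv_diff pderiv_smult pderiv_mult pderiv_pCons algebra_simps smult_diff_left)
  have "pderiv q * pderiv h = q * pderiv (pderiv h)"
    unfolding q' unfolding q_def using hess by (simp add: algebra_simps power2_eq_square)
  then obtain c where c: "q = smult c (pderiv h)"
    using proportional_of_wronskian_eq_0[OF _ h'] by blast
  then have h: "smult (real n) h = [:c, 1:] * pderiv h"
    by (simp add: q_def algebra_simps)
  have "smult (real n - 1) (pderiv h) = [:c, 1:] * pderiv (pderiv h)"
    using arg_cong[OF c, of pderiv] by (simp add: q' pderiv_smult algebra_simps)
  then have "smult (real n - 1) (smult (real n) h) = [:c, 1:] * ([:c, 1:] * pderiv (pderiv h))"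
    unfolding h by (metis mult_smult_right)
  moreover have "h = smult (1 / ((real n - 1) * real n)) (smult (real n - 1) (smult (real n) h))"
    using n by simp
  ultimately have "h = smult (1 / ((real n - 1) * real n)) ([:c, 1:] * ([:c, 1:] * pderiv (pderiv h)))"
    by simp
  then have "h = [:- (- c), 1:]^2 * smult (1 / ((real n - 1) * real n)) (pderiv (pderiv h))"
    by (simp only: power2_eq_square mult.assoc minus_minus mult_smult_right)
  then show ?thesis using that by blast
qed

definition homogenize :: "nat \<Rightarrow> real poly \<Rightarrow> real poly poly" where
  "homogenize n h = (\<Sum>j\<le>n. monom (monom (coeff h j) (n - j)) j)"

lemma coeff_homogenize:
  "coeff (homogenize n h) j = (if j \<le> n then monom (coeff h j) (n - j) else 0)"
  by (simp add: homogenize_def coeff_sum)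

lemma homogeneous_part_eq_homogenize: "homogeneous_part n f = homogenize n (top_polynomial f n)"
  by (simp add: homogeneous_part_def homogenize_def coeff_top_polynomial)

text \<open>
  The root \<open>s\<close> of the dehomogenized polynomial becomes the factor \<open>y - s x\<close> of the form.
\<close>

lemma homogenize_linear_mult:
  assumes "degree k \<le> m"
  shows "homogenize (Suc m) ([:- s, 1:] * k) = [:[:0, - s:], 1:] * homogenize m k"
proof (rule poly_eqI)
  fix j
  have k: "coeff k (Suc m) = 0" using assms by (simp add: coeff_eq_0)
  have X: "[:0, a:] * monom b i = monom (a * b) (Suc i)" for a b :: real and i
    by (simp add: monom_Suc smult_monom)
  show "coeff (homogenize (Suc m) ([:- s, 1:] * k)) j = coeff ([:[:0, - s:], 1:] * homogenize m k) j"
  proof (cases j)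
    case 0
    then show ?thesis by (simp add: coeff_homogenize X coeff_mult_0 del: mult_pCons_left)
  next
    case (Suc i)
    consider "i < m" | "i = m" | "i > m" by linarith
    then show ?thesis
    proof cases
      case 1
      then have i: "m - i = Suc (m - Suc i)" by simp
      have "coeff ([:[:0, - s:], 1:] * homogenize m k) j =
          [:0, - s:] * coeff (homogenize m k) (Suc i) + coeff (homogenize m k) i"
        by (simp add: Suc)
      also have "\<dots> = monom (coeff k i - s * coeff k (Suc i)) (m - i)"
        using 1 unfolding coeff_homogenize by (simp add: X i add_monom del: mult_pCons_left)
      finally show ?thesis
        using 1 by (simp add: Suc coeff_homogenize)
    qed (auto simp: Suc coeff_homogenize k)
  qed
qed

lemma total_degree_eqI:
  assumes "coeff (coeff l j) i \<noteq> 0" "i + j = d" "\<And>i j. coeff (coeff l j) i \<noteq> 0 \<Longrightarrow> i + j \<le> d"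
  shows "total_degree l = d"
  unfolding total_degree_def
proof (rule Max_eqI)
  show "finite (insert 0 {i + j | i j. coeff (coeff l j) i \<noteq> 0})"
    by (auto simp: degrees_eq_image finite_monomials)
qed (use assms in auto)

lemma total_degree_linear: "total_degree [:[:0, - s:], 1:] = 1"
  by (rule total_degree_eqI[where i = 0 and j = 1])
     (auto simp: coeff_pCons one_pCons split: nat.splits)

lemma total_degree_x: "total_degree [:[:0, 1:]:] = 1"
  by (rule total_degree_eqI[where i = 1 and j = 0])
     (auto simp: coeff_pCons split: nat.splits)

text \<open>
  A constant \<open>h\<close> comes from the form \<open>c x\<^sup>n\<close>, whose repeated factor \<open>x\<close> is not visible in \<open>h\<close>.
\<close>

lemma repeated_factor_of_hessian_eq_0:
  assumes n: "n \<ge> 2" and deg: "degree h \<le> n"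
    and hess: "smult (real n) (h * pderiv (pderiv h)) = smult (real n - 1) ((pderiv h)^2)"
  shows "\<not> no_repeated_linear_factor (homogenize n h)"
proof (cases "pderiv h = 0")
  case True
  then obtain c where c: "h = [:c:]" using pderiv_iszero by blast
  have "homogenize n h = [:monom c n:]"
    by (rule poly_eqI) (auto simp: c coeff_homogenize coeff_pCons split: nat.splits)
  also have "monom c n = [:0, 1:]^2 * monom c (n - 2)"
    using n by (simp add: power2_eq_square flip: monom_Suc) (simp add: numeral_2_eq_2 Suc_diff_Suc)
  also have "[:[:0, 1:]^2 * monom c (n - 2):] = [:[:0, 1:]:]^2 * [:monom c (n - 2):]"
    by (simp add: power2_eq_square)
  finally show ?thesis
    unfolding no_repeated_linear_factor_def using total_degree_x by (metis dvd_triv_left)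
next
  case False
  then obtain s k where h: "h = [:-s, 1:]^2 * k"
    using double_root_of_hessian_eq_0[OF hess n] by blast
  with False have "k \<noteq> 0" by auto
  then have "degree h = 2 + degree k"
    by (simp add: h degree_mult_eq degree_power_eq)
  then have k: "degree k \<le> n - 2" "degree ([:-s, 1:] * k) \<le> Suc (n - 2)"
    using deg n \<open>k \<noteq> 0\<close> by (auto simp: degree_mult_eq simp del: mult_pCons_left)
  have "homogenize n h = homogenize (Suc (Suc (n - 2))) ([:-s, 1:] * ([:-s, 1:] * k))"
  proof -
    have "Suc (Suc (n - 2)) = n" using n by simp
    then show ?thesis by (simp only: h power2_eq_square mult.assoc)
  qed
  also have "\<dots> = [:[:0, - s:], 1:]^2 * homogenize (n - 2) k"
    unfolding homogenize_linear_mult[OF k(2)] homogenize_linear_mult[OF k(1)]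
    by (simp only: power2_eq_square mult.assoc)
  finally show ?thesis
    unfolding no_repeated_linear_factor_def using total_degree_linear by (metis dvd_triv_left)
qed


section \<open>The equator as an integral curve\<close>

lemma equator_has_nonsingular_point:
  assumes f: "total_degree f = n" and n: "n \<ge> 2"
    and simple: "no_repeated_linear_factor (homogeneous_part n f)"
  shows "\<exists>t. equator t \<notin> singular_points (projective_form f n)"
proof (rule ccontr)
  assume "\<not> ?thesis"
  then have mixed: "equator_mixed f n (cos t) (sin t) = 0" for t
    using equator_singular_iff by blast
  define h where "h = top_polynomial f n"
  define H where "H = smult (real n) (h * pderiv (pderiv h)) - smult (real n - 1) ((pderiv h)^2)"
  have "poly (h * H) y = 0" for y
  proof -
    \<comment> \<open>By homogeneity the point \<open>(1, y)\<close> may be moved to the unit circle.\<close>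
    define r where "r = 1 / sqrt (1 + y^2)"
    have pos: "1 + y^2 > 0" by (simp add: add_pos_nonneg)
    then have r: "r > 0" "r^2 + (r * y)^2 = 1"
      by (simp_all add: r_def power_divide power_mult_distrib field_simps)
    obtain t where "r = cos t" "r * y = sin t"
      using r(2) sincos_total_2pi by metis
    then have "equator_mixed f n 1 y = 0"
      using equator_mixed_scale[of n r f 1 y] mixed[of t] n r(1) by simp
    then have "real n * (1 + y^2) * poly (h * H) y = 0"
      using equator_mixed_eq_hessian[OF n, of f y] by (simp add: h_def H_def)
    then show ?thesis using n pos by simp
  qed
  then have "h * H = 0" using poly_all_0_iff_0 by blast
  moreover have "h \<noteq> 0"
  proof -
    obtain i j where "coeff (coeff f j) i \<noteq> 0" "i + j = n"
      using total_degree_attained[of f] f n by (metis less_le_trans zero_less_numeral)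
    then have "coeff h j \<noteq> 0" by (auto simp: h_def coeff_top_polynomial)
    then show ?thesis by auto
  qed
  ultimately have "H = 0" by simp
  moreover have "degree h \<le> n"
    by (rule degree_le) (simp add: h_def coeff_top_polynomial)
  ultimately have "\<not> no_repeated_linear_factor (homogenize n h)"
    using n by (intro repeated_factor_of_hessian_eq_0) (auto simp: H_def)
  with simple show False
    by (simp add: homogeneous_part_eq_homogenize h_def)
qed

text \<open>
  On the equator the field has to be the tangent; elsewhere any zero direction may be chosen, since
  solution fields need not be continuous.
\<close>

lemma solution_field_through_equator:
  assumes f: "total_degree f \<le> n" and n: "n \<ge> 2"
  obtains L where "solution_field (projective_form f n) L"
    and "\<And>t. vector [- sin t, cos t, 0] \<in> L (equator t)"
proof -
  define \<Phi> where "\<Phi> = projective_form f n"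
  define X where "X p = (if p$3 = 0 then vector [- p$2, p$1, 0] else
      (SOME X. X \<noteq> 0 \<and> X \<in> zero_locus \<Phi> p))" for p :: "real^3"
  have X: "X p \<noteq> 0 \<and> X p \<in> zero_locus \<Phi> p" if "p \<in> S2" for p
  proof (cases "p$3 = 0")
    case True
    then have "(p$1)^2 + (p$2)^2 = 1" using that unfolding mem_S2_iff by simp
    then have "X p \<noteq> 0" using True by (auto simp: X_def vec_eq_iff forall_3)
    then show ?thesis
      using True by (simp add: X_def zero_locus_def tangent_space_def inner_3 \<Phi>_def projective_form_def)
  next
    case False
    then have "\<exists>X. X \<noteq> 0 \<and> X \<in> zero_locus \<Phi> p"
      using projective_form_has_zero_direction[OF f n that] unfolding \<Phi>_def by metis
    then show ?thesis
      using False someI_ex[of "\<lambda>X. X \<noteq> 0 \<and> X \<in> zero_locus \<Phi> p"] by (simp add: X_def)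
  qed
  have "solution_field \<Phi> (\<lambda>p. span {X p})"
    unfolding solution_field_def
  proof (intro ballI conjI)
    fix p assume "p \<in> S2 - singular_points \<Phi>"
    then have p: "X p \<noteq> 0" "X p \<in> zero_locus \<Phi> p" using X by auto
    show "subspace (span {X p})" by (rule subspace_span)
    show "dim (span {X p}) = 1" using p(1) by (simp add: dim_span dim_eq_card_independent)
    show "span {X p} \<subseteq> zero_locus \<Phi> p"
      using p(2) by (auto simp: span_singleton zero_locus_def tangent_space_def \<Phi>_def projective_form_scale)
  qed
  moreover have "vector [- sin t, cos t, 0] \<in> span {X (equator t)}" for t
    by (rule span_base) (simp add: X_def)
  ultimately show ?thesis
    using that unfolding \<Phi>_def by blast
qed

lemma equator_has_vector_derivative:
  "(equator has_vector_derivative vector [- sin t, cos t, 0]) (at t)"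
proof -
  have "((\<lambda>t. equator t $ i) has_real_derivative vector [- sin t, cos t, 0] $ i) (at t)" for i :: 3
    using exhaust_3[of i] by (auto intro!: derivative_eq_intros)
  then show ?thesis
    unfolding has_vector_derivative_def has_derivative_componentwise_within[of equator]
    by (auto simp: Basis_vec_def inner_axis has_field_derivative_def mult_commute_abs)
qed

theorem theorem3p2:
  fixes f :: "real poly poly" and n :: nat
  assumes "total_degree f = n" and "n \<ge> 2"
  shows "\<exists>\<Phi> :: real^3 \<Rightarrow> real^3 \<Rightarrow> real.
    analytic_quadratic_form \<Phi> \<and>
    (\<forall>q \<in> upper_hemisphere. zero_locus \<Phi> q = zero_locus (induced_form s1 (principal_form f)) q) \<and>
    (\<forall>q \<in> lower_hemisphere. zero_locus \<Phi> q = zero_locus (induced_form s2 (principal_form f)) q) \<and>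
    (no_repeated_linear_factor (homogeneous_part n f) \<longrightarrow>
      (\<exists>L. solution_field \<Phi> L \<and>
           integral_curve L equator {t. equator t \<notin> singular_points \<Phi>}))"
proof (intro exI[of _ "projective_form f n"] conjI ballI impI)
  have f: "total_degree f \<le> n" using assms(1) by simp
  show "analytic_quadratic_form (projective_form f n)"
    by (rule analytic_projective_form)
  show "zero_locus (projective_form f n) q = zero_locus (induced_form s1 (principal_form f)) q"
    if "q \<in> upper_hemisphere" for q
    by (rule zero_locus_upper[OF f assms(2) that])
  show "zero_locus (projective_form f n) q = zero_locus (induced_form s2 (principal_form f)) q"
    if "q \<in> lower_hemisphere" for q
    by (rule zero_locus_lower[OF f assms(2) that])
  assume simple: "no_repeated_linear_factor (homogeneous_part n f)"
  obtain L where L: "solution_field (projective_form f n) L"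
    "\<And>t. vector [- sin t, cos t, 0] \<in> L (equator t)"
    using solution_field_through_equator[OF f assms(2)] by blast
  have "vector [- sin t, cos t, 0] \<noteq> (0 :: real^3)" for t
    using sin_zero_abs_cos_one[of t] by (auto simp: vec_eq_iff forall_3)
  then have "integral_curve L equator {t. equator t \<notin> singular_points (projective_form f n)}"
    unfolding integral_curve_def
    using open_equator_nonsingular equator_has_nonsingular_point[OF assms simple]
      equator_has_vector_derivative L(2) by blast
  with L(1) show "\<exists>L. solution_field (projective_form f n) L \<and>
      integral_curve L equator {t. equator t \<notin> singular_points (projective_form f n)}"
    by blast
qed

end
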